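(* Let $Q\in\mathbb{R}^{n\times n}$ be a symmetric matrix, $A\in\mathbb{R}^{m\times n}$, $q\in\mathbb{R}^n$, $b\in\mathbb{R}^m$, let $f(x)=\frac12 x^\top Qx+q^\top x$, and assume that $C=\{x\in\mathbb{R}^n\mid Ax\ge b\}$ is nonempty. Let $C_*$ be the set of KKT points of the problem $\min\{f(x)\mid x\in C\}$. Let $\eta$ and $\rho$ be positive constants. If $f$ is bounded below on $C$, then for any $x^0\in C$ the unique solution $x(\cdot)$ on $[0,+\infty)$ of $$\dot x(t)=\frac1\eta\Big[P_C\Big(x(t)-\frac1\rho\big(Qx(t)+q\big)\Big)-x(t)\Big]\quad (t\ge 0),\qquad x(0)=x^0,$$ satisfies $$\lim_{t\to+\infty} d(x(t),C_* )=0.$$ Moreover, there exists a connected component $\Omega$ of $C_*$, which is a union of finitely many polyhedral convex sets (hence it is closed), such that $$\lim_{t\to+\infty} d(x(t),\Omega)=0.$$ In particular, if the problem has finitely many KKT points, then there is a KKT point $\bar x$ such that $\lim_{t\to+\infty}x(t)=\bar x$.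
   Context: $\mathbb{R}^n$ carries the Euclidean scalar product and norm. Inequalities between vectors are componentwise. $P_C$ is the metric projection onto the closed convex set $C$, i.e. $P_C(x)$ is the unique $y\in C$ with $\|y-x\|=\inf_{z\in C}\|z-x\|$. For a set $S$, $d(x,S)=\inf_{y\in S}\|x-y\|$. A point $x\in\mathbb{R}^n$ is a Karush-Kuhn-Tucker (KKT) point of $\min\{f(x)\mid Ax\ge b\}$ if there is $\lambda\in\mathbb{R}^m$ with $Qx+q-A^\top\lambda=0$, $Ax\ge b$, $\lambda\ge 0$, $\lambda^\top(Ax-b)=0$. It is known that for every $x^0\in\mathbb{R}^n$, $\rho>0$, $\eta>0$ the initial value problem $\dot x(t)=\frac1\eta\big[P_C\big(x(t)-\frac1\rho(Qx(t)+q)\big)-x(t)\big]$ $(t\ge 0)$, $x(0)=x^0$, has a unique $C^1$ solution $x:[0,+\infty)\to\mathbb{R}^n$. *)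

theory Defs
  imports "HOL-Analysis.Analysis"
begin

definition quad_fun :: "real^'n^'n \<Rightarrow> real^'n \<Rightarrow> real^'n \<Rightarrow> real" where
  "quad_fun Q q x = (1/2) * (x \<bullet> (Q *v x)) + q \<bullet> x"

text \<open>The order on \<open>real^'m\<close> is the componentwise one.\<close>

definition feasible :: "real^'n^'m \<Rightarrow> real^'m \<Rightarrow> (real^'n) set" where
  "feasible A b = {x. A *v x \<ge> b}"

definition KKT_points ::
    "real^'n^'n \<Rightarrow> real^'n \<Rightarrow> real^'n^'m \<Rightarrow> real^'m \<Rightarrow> (real^'n) set" where
  "KKT_points Q q A b =
     {x. \<exists>l. Q *v x + q - transpose A *v l = 0 \<and> A *v x \<ge> b \<and> l \<ge> 0 \<and>
             l \<bullet> (A *v x - b) = 0}"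

text \<open>
  For closed convex nonempty \<open>C\<close>, \<open>closest_point C\<close> is the metric projection onto \<open>C\<close>.
  The derivative at \<open>t = 0\<close> is one-sided.  The right-hand side depends continuously on the
  state, so every solution in this sense is automatically continuously differentiable
  on \<open>{0..}\<close>; values of \<open>x\<close> at negative times are irrelevant.
\<close>

definition solves_projected_ivp ::
    "real \<Rightarrow> real \<Rightarrow> real^'n^'n \<Rightarrow> real^'n \<Rightarrow> (real^'n) set \<Rightarrow> real^'n \<Rightarrow>
     (real \<Rightarrow> real^'n) \<Rightarrow> bool" where
  "solves_projected_ivp \<eta> \<rho> Q q C x0 x \<longleftrightarrow>
     x 0 = x0 \<and>
     (\<forall>t\<ge>0. (x has_vector_derivative
        (1/\<eta>) *\<^sub>R (closest_point C (x t - (1/\<rho>) *\<^sub>R (Q *v x t + q)) - x t))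
        (at t within {0..}))"

end

theory Submission
  imports Defs
begin

text \<open>
  Let \<open>r(t)\<close> be the residual, the difference between the projected gradient step from
  \<open>x(t)\<close> and \<open>x(t)\<close> itself, so that \<open>x' = r / \<eta>\<close>.  KKT points are exactly the feasible
  points with zero residual.  Trajectories may be unbounded, so limit points cannot be used; the
  argument rests on the polyhedral structure instead, in three steps.

  First, the residual tends to zero.  Trajectories starting in the feasible set stay there
  (\<open>trajectory_stays_feasible\<close>), and on it the objective decreases at a rate of at least
  \<open>(\<rho> / \<eta>) * norm (r t) ^ 2\<close>.  The objective is bounded below and \<open>r\<close> cannot change quickly
  relative to its size, which forces \<open>r\<close> to vanish in the limit
  (\<open>residual_vanishes_by_energy_decay\<close>).

  Second, a small residual means that a KKT point is near, uniformly in the state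
  (\<open>small_residual_imp_near_KKT\<close>).  The optimality condition of the projection is a slightly
  perturbed KKT system.  For a fixed choice of tight constraints that system says that an affine
  image of the state lies in a polyhedron, and by Hoffman's bound (\<open>hoffman_bound\<close>,
  \<open>near_polyhedron_imp_near_affine_vimage\<close>) states that satisfy it nearly are close to states that
  satisfy it exactly.  In particular KKT points exist.

  Third, the KKT points form a finite union of polyhedra (\<open>KKT_points_eq_pieces\<close>).  Disjoint
  polyhedra have positive distance, again by Hoffman's bound, so the components of this union are
  uniformly separated and each of them is a finite union of polyhedra.  A continuous path
  approaching the union must therefore approach a single component
  (\<open>path_selects_component\<close>).  A finite connected set is a singleton, and approaching a singleton
  is convergence.
\<close>

section \<open>Polyhedra as solution sets of linear systems\<close>

lemma polyhedron_halfspaces: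
  fixes P :: "'a::euclidean_space set"
  assumes "polyhedron P"
  obtains F :: "'a set set" and a b
  where "finite F" and "P = {x. \<forall>h\<in>F. a h \<bullet> x \<le> b h}"
proof -
  obtain F where F: "finite F" "P = \<Inter>F"
    and "\<forall>h\<in>F. \<exists>a b. a \<noteq> 0 \<and> h = {x. a \<bullet> x \<le> b}"
    using assms unfolding polyhedron_def by blast
  then obtain a b where "\<forall>h\<in>F. h = {x. a h \<bullet> x \<le> b h}"
    by metis
  then have "P = {x. \<forall>h\<in>F. a h \<bullet> x \<le> b h}"
    unfolding F(2) by blast
  then show thesis
    using that F(1) by blast
qed

lemma polyhedron_system:
  fixes a :: "'i \<Rightarrow> 'a::euclidean_space"
  assumes "finite I"
  shows "polyhedron {x. \<forall>i\<in>I. a i \<bullet> x \<le> b i}"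
proof -
  have "{x. \<forall>i\<in>I. a i \<bullet> x \<le> b i} = \<Inter>((\<lambda>i. {x. a i \<bullet> x \<le> b i}) ` I)"
    by blast
  then show ?thesis
    using assms by (auto intro!: polyhedron_Inter polyhedron_halfspace_le)
qed

lemma affine_vimage_halfspaces:
  fixes g :: "'a::euclidean_space \<Rightarrow> 'b::euclidean_space"
  assumes "linear g"
  shows "c \<bullet> (g y + v) \<le> d \<longleftrightarrow> adjoint g c \<bullet> y \<le> d - c \<bullet> v"
proof -
  have "c \<bullet> g y = adjoint g c \<bullet> y"
    using adjoint_works[OF assms, of y c] by (simp add: inner_commute)
  then show ?thesis
    by (simp add: inner_add_right) argo
qed

lemma polyhedron_affine_vimage:
  fixes g :: "'a::euclidean_space \<Rightarrow> 'b::euclidean_space"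
  assumes "polyhedron P" and g: "linear g"
  shows "polyhedron {y. g y + v \<in> P}"
proof -
  obtain F :: "'b set set" and a b where F: "finite F" "P = {x. \<forall>h\<in>F. a h \<bullet> x \<le> b h}"
    using polyhedron_halfspaces[OF assms(1)] by blast
  have "{y. g y + v \<in> P} = {y. \<forall>h\<in>F. adjoint g (a h) \<bullet> y \<le> b h - a h \<bullet> v}"
    by (simp add: F(2) affine_vimage_halfspaces[OF g])
  then show ?thesis
    using polyhedron_system[OF F(1)] by simp
qed

lemma polyhedron_Times:
  fixes P :: "'a::euclidean_space set" and R :: "'b::euclidean_space set"
  assumes "polyhedron P" and "polyhedron R"
  shows "polyhedron (P \<times> R)"
proof -
  have "P \<times> R = {z. fst z + 0 \<in> P} \<inter> {z. snd z + 0 \<in> R}"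
    by auto
  then show ?thesis
    using polyhedron_Int[OF polyhedron_affine_vimage[OF assms(1) linear_fst, of 0]
        polyhedron_affine_vimage[OF assms(2) linear_snd, of 0]]
    by simp
qed

section \<open>Finitely generated cones\<close>

lemma convex_cone_hull_image_explicit:
  fixes a :: "'i \<Rightarrow> 'a::real_vector"
  assumes "finite J"
  shows "u \<in> convex_cone hull (a ` J) \<longleftrightarrow> (\<exists>m. (\<forall>i\<in>J. 0 \<le> m i) \<and> u = (\<Sum>i\<in>J. m i *\<^sub>R a i))"
    (is "_ \<longleftrightarrow> ?comb u")
proof
  have "convex_cone {u. ?comb u}"
    unfolding convex_cone_iff
  proof (intro conjI ballI allI impI)
    show "0 \<in> {u. ?comb u}"
      by (auto intro!: exI[of _ "\<lambda>_. 0"])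
  next
    fix u v assume "u \<in> {u. ?comb u}" "v \<in> {u. ?comb u}"
    then obtain m m' where "\<forall>i\<in>J. 0 \<le> m i" "u = (\<Sum>i\<in>J. m i *\<^sub>R a i)"
      "\<forall>i\<in>J. 0 \<le> m' i" "v = (\<Sum>i\<in>J. m' i *\<^sub>R a i)"
      by auto
    then show "u + v \<in> {u. ?comb u}"
      by (auto intro!: exI[of _ "\<lambda>i. m i + m' i"] simp: scaleR_add_left sum.distrib)
  next
    fix u and c :: real assume "u \<in> {u. ?comb u}" "0 \<le> c"
    then obtain m where "\<forall>i\<in>J. 0 \<le> m i" "u = (\<Sum>i\<in>J. m i *\<^sub>R a i)"
      by auto
    then show "c *\<^sub>R u \<in> {u. ?comb u}"
      using \<open>0 \<le> c\<close> by (auto intro!: exI[of _ "\<lambda>i. c * m i"] simp: scaleR_sum_right)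
  qed
  moreover have "a ` J \<subseteq> {u. ?comb u}"
  proof clarify
    fix j assume "j \<in> J"
    then have "(\<Sum>i\<in>J. (if i = j then 1 else 0) *\<^sub>R a i) = a j"
      using assms by (simp add: if_distrib[of "\<lambda>c. c *\<^sub>R _"] cong: if_cong)
    then show "?comb (a j)"
      by (intro exI[of _ "\<lambda>i. if i = j then 1 else 0"]) auto
  qed
  ultimately have "convex_cone hull (a ` J) \<subseteq> {u. ?comb u}"
    by (simp add: hull_minimal)
  then show "?comb u" if "u \<in> convex_cone hull (a ` J)"
    using that by blast
next
  assume "?comb u"
  then obtain m where m: "\<forall>i\<in>J. 0 \<le> m i" and u: "u = (\<Sum>i\<in>J. m i *\<^sub>R a i)"
    by blast
  have "(\<Sum>i\<in>J. m i *\<^sub>R a i) \<in> convex_cone hull (a ` J)"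
    using assms m
  proof (induction J rule: finite_induct)
    case empty
    then show ?case by simp
  next
    case (insert j J)
    have "a ` J \<subseteq> a ` insert j J"
      by blast
    then have "(\<Sum>i\<in>J. m i *\<^sub>R a i) \<in> convex_cone hull (a ` insert j J)"
      using insert hull_mono by blast
    moreover have "m j *\<^sub>R a j \<in> convex_cone hull (a ` insert j J)"
      using insert.prems by (intro convex_cone_hull_mul hull_inc) auto
    ultimately show ?case
      using insert.hyps by (simp add: convex_cone_hull_add)
  qed
  then show "u \<in> convex_cone hull (a ` J)"
    by (simp add: u)
qed

text \<open>
  The inhomogeneous Farkas lemma.  If a normal vector \<open>u\<close> lay outside the cone of the active
  constraint vectors, which is closed because it is finitely generated, a hyperplane would separate
  it from the cone; the separating direction is then feasible at \<open>y\<close> and makes a positive angle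
  with \<open>u\<close>, contradicting normality.
\<close>

lemma normal_cone_of_system:
  fixes a :: "'i \<Rightarrow> 'a::euclidean_space"
  assumes fin: "finite I"
    and y: "\<forall>i\<in>I. a i \<bullet> y \<le> b i"
    and normal: "\<And>z. \<forall>i\<in>I. a i \<bullet> z \<le> b i \<Longrightarrow> u \<bullet> (z - y) \<le> 0"
  shows "u \<in> convex_cone hull (a ` {i\<in>I. a i \<bullet> y = b i})"
proof (rule ccontr)
  let ?J = "{i\<in>I. a i \<bullet> y = b i}"
  let ?K = "convex_cone hull (a ` ?J)"
  assume "u \<notin> ?K"
  moreover have "closed ?K"
    using fin by (simp add: closed_convex_cone_hull)
  ultimately obtain e \<beta> where sep: "e \<bullet> u < \<beta>" "\<And>k. k \<in> ?K \<Longrightarrow> e \<bullet> k > \<beta>"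
    using separating_hyperplane_closed_point[of ?K u] convex_convex_cone_hull by blast
  have "\<beta> < 0"
    using sep(2)[OF convex_cone_hull_contains_0] by simp
  have pos: "e \<bullet> a i \<ge> 0" if "i \<in> ?J" for i
  proof (rule ccontr)
    assume "\<not> e \<bullet> a i \<ge> 0"
    then have neg: "e \<bullet> a i < 0" by simp
    have "(\<beta> / (e \<bullet> a i)) *\<^sub>R a i \<in> ?K"
      using neg \<open>\<beta> < 0\<close> that by (intro convex_cone_hull_mul hull_inc) (auto simp: divide_nonpos_neg)
    from sep(2)[OF this] show False
      using neg by simp
  qed
  \<comment> \<open>A short step from y in the direction -e keeps the inactive constraints.\<close>
  have "\<exists>t>0. \<forall>i\<in>I. a i \<bullet> (y - t *\<^sub>R e) \<le> b i"
  proof -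
    have "\<forall>\<^sub>F t in at_right 0. a i \<bullet> (y - t *\<^sub>R e) \<le> b i" if "i \<in> I" for i
    proof (cases "a i \<bullet> y = b i")
      case True
      have "\<forall>\<^sub>F t::real in at_right 0. 0 < t"
        by (simp add: eventually_at_right_less)
      then show ?thesis
      proof eventually_elim
        case (elim t)
        have "0 \<le> t * (e \<bullet> a i)"
          using pos[of i] that True elim by simp
        then show ?case
          using True by (simp add: inner_diff_right inner_commute)
      qed
    next
      case False
      have "((\<lambda>t. a i \<bullet> (y - t *\<^sub>R e)) \<longlongrightarrow> a i \<bullet> (y - 0 *\<^sub>R e)) (at_right 0)"
        by (intro tendsto_intros)
      then have "\<forall>\<^sub>F t in at_right 0. a i \<bullet> (y - t *\<^sub>R e) < b i"
        by (rule order_tendstoD(2)) (use False y that in force)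
      then show ?thesis
        by eventually_elim simp
    qed
    then have "\<forall>\<^sub>F t in at_right 0. \<forall>i\<in>I. a i \<bullet> (y - t *\<^sub>R e) \<le> b i"
      using fin by (simp add: eventually_ball_finite)
    then have "\<forall>\<^sub>F t in at_right (0::real). 0 < t \<and> (\<forall>i\<in>I. a i \<bullet> (y - t *\<^sub>R e) \<le> b i)"
      by (intro eventually_conj eventually_at_right_less)
    then show ?thesis
      using eventually_happens[of _ "at_right (0::real)"] by fastforce
  qed
  then obtain t where t: "t > 0" "\<forall>i\<in>I. a i \<bullet> (y - t *\<^sub>R e) \<le> b i"
    by blast
  have "0 \<le> t * (u \<bullet> e)"
    using normal[OF t(2)] by simp
  then show False
    using t(1) sep(1) \<open>\<beta> < 0\<close> by (simp add: zero_le_mult_iff inner_commute)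
qed

text \<open>
  This is a dual form of the fact that an element \<open>u\<close> of the cone generated by \<open>G\<close> is a
  nonnegative combination of \<open>G\<close> with coefficients of total size at most \<open>c * norm u\<close>.  The
  reason is that the polytope \<open>convex hull (insert 0 G)\<close> is cut out by finitely many half-spaces:
  those whose boundary passes through \<open>0\<close> contain the whole cone, and the others contain a ball
  around \<open>0\<close>.  Hence the polytope contains all short elements of the cone, and scaling gives
  the constant.
\<close>

lemma cone_bounded_generation:
  fixes G :: "'a::euclidean_space set"
  assumes "finite G"
  obtains c where "c > 0"
    and "\<And>u e s. \<lbrakk>u \<in> convex_cone hull G; 0 \<le> s; \<And>g. g \<in> G \<Longrightarrow> g \<bullet> e \<le> s\<rbrakk>
           \<Longrightarrow> u \<bullet> e \<le> c * norm u * s"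
proof -
  let ?B = "convex hull (insert 0 G)"
  have "polyhedron ?B"
    using assms by (intro polyhedron_convex_hull) simp
  then obtain F :: "'a set set" and a b where fin: "finite F" and B: "?B = {x. \<forall>h\<in>F. a h \<bullet> x \<le> b h}"
    using polyhedron_halfspaces by blast
  have "0 \<in> ?B" by (simp add: hull_inc)
  then have b0: "0 \<le> b h" if "h \<in> F" for h
    using B that by auto
  have "\<exists>\<delta>>0. \<forall>h\<in>F. b h > 0 \<longrightarrow> \<delta> * norm (a h) \<le> b h"
  proof -
    have "\<forall>\<^sub>F \<delta> in at_right 0. b h > 0 \<longrightarrow> \<delta> * norm (a h) \<le> b h" if "h \<in> F" for h
    proof (cases "b h > 0")
      case True
      have "((\<lambda>\<delta>. \<delta> * norm (a h)) \<longlongrightarrow> 0 * norm (a h)) (at_right 0)"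
        by (intro tendsto_intros)
      then have "\<forall>\<^sub>F \<delta> in at_right 0. \<delta> * norm (a h) < b h"
        by (rule order_tendstoD(2)) (use True in simp)
      then show ?thesis
        by eventually_elim simp
    qed simp
    then have "\<forall>\<^sub>F \<delta> in at_right 0. \<forall>h\<in>F. b h > 0 \<longrightarrow> \<delta> * norm (a h) \<le> b h"
      using fin by (simp add: eventually_ball_finite)
    then have "\<forall>\<^sub>F \<delta> in at_right (0::real). 0 < \<delta> \<and> (\<forall>h\<in>F. b h > 0 \<longrightarrow> \<delta> * norm (a h) \<le> b h)"
      by (intro eventually_conj eventually_at_right_less)
    then show ?thesis
      using eventually_happens[of _ "at_right (0::real)"] by fastforce
  qed
  then obtain \<delta> where \<delta>: "\<delta> > 0" "\<And>h. h \<in> F \<Longrightarrow> b h > 0 \<Longrightarrow> \<delta> * norm (a h) \<le> b h"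
    by blast
  \<comment> \<open>Within distance \<open>\<delta>\<close> of the apex, the cone and the polytope coincide.\<close>
  have near: "u \<in> ?B" if u: "u \<in> convex_cone hull G" and small: "norm u \<le> \<delta>" for u
  proof -
    have "a h \<bullet> u \<le> b h" if h: "h \<in> F" for h
    proof (cases "b h > 0")
      case True
      have "a h \<bullet> u \<le> norm (a h) * norm u"
        by (rule norm_cauchy_schwarz)
      also have "\<dots> \<le> norm (a h) * \<delta>"
        using small by (simp add: mult_left_mono)
      also have "\<dots> \<le> b h"
        using \<delta>(2)[OF h True] by (simp add: mult.commute)
      finally show ?thesis .
    next
      case False
      then have "b h = 0" using b0[OF h] by simp
      have "G \<subseteq> {x. a h \<bullet> x \<le> 0}"
      proof
        fix g assume "g \<in> G"
        then have "g \<in> ?B" by (simp add: hull_inc)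
        then show "g \<in> {x. a h \<bullet> x \<le> 0}"
          using B h \<open>b h = 0\<close> by auto
      qed
      then have "convex_cone hull G \<subseteq> {x. a h \<bullet> x \<le> 0}"
        by (rule hull_minimal) (rule convex_cone_halfspace_le)
      then show ?thesis
        using u \<open>b h = 0\<close> by auto
    qed
    then show ?thesis using B by blast
  qed
  show thesis
  proof
    show "1 / \<delta> > 0" using \<delta>(1) by simp
  next
    fix u e :: 'a and s :: real
    assume u: "u \<in> convex_cone hull G" and s: "0 \<le> s" and e: "\<And>g. g \<in> G \<Longrightarrow> g \<bullet> e \<le> s"
    show "u \<bullet> e \<le> 1 / \<delta> * norm u * s"
    proof (cases "u = 0")
      case False
      let ?v = "(\<delta> / norm u) *\<^sub>R u"
      have "?v \<in> convex_cone hull G"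
        using u \<delta>(1) by (intro convex_cone_hull_mul) auto
      then have "?v \<in> ?B"
        using False \<delta>(1) by (intro near) auto
      moreover have "insert 0 G \<subseteq> {x. e \<bullet> x \<le> s}"
        using e s by (auto simp: inner_commute)
      then have "?B \<subseteq> {x. e \<bullet> x \<le> s}"
        by (rule hull_minimal) (rule convex_halfspace_le)
      ultimately have "e \<bullet> ?v \<le> s" by blast
      then show ?thesis
        using False \<delta>(1) by (simp add: field_simps inner_commute)
    qed simp
  qed
qed

section \<open>Hoffman bounds\<close>

text \<open>
  Hoffman's error bound.  Let \<open>y\<close> be the projection of \<open>z\<close> onto the solution set.  By
  Farkas, \<open>z - y\<close> lies in the cone of the constraint vectors active at \<open>y\<close>, and each of these
  has inner product at most \<open>s\<close> with \<open>z - y\<close>.  Testing \<open>z - y\<close> against itself with the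
  preceding cone estimate yields \<open>norm (z - y) ^ 2 \<le> c * norm (z - y) * s\<close>.  Only finitely many
  active sets occur, so one constant serves all of them.
\<close>

lemma hoffman_bound:
  fixes a :: "'i \<Rightarrow> 'a::euclidean_space"
  assumes fin: "finite I" and ne: "{x. \<forall>i\<in>I. a i \<bullet> x \<le> b i} \<noteq> {}"
  obtains c where "c > 0"
    and "\<And>z s. \<lbrakk>0 \<le> s; \<forall>i\<in>I. a i \<bullet> z \<le> b i + s\<rbrakk>
           \<Longrightarrow> \<exists>y. (\<forall>i\<in>I. a i \<bullet> y \<le> b i) \<and> dist z y \<le> c * s"
proof -
  let ?S = "{x. \<forall>i\<in>I. a i \<bullet> x \<le> b i}"
  have "\<exists>c>0. \<forall>u e s. u \<in> convex_cone hull (a ` J) \<longrightarrow> 0 \<le> s \<longrightarrow> (\<forall>i\<in>J. a i \<bullet> e \<le> s)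
          \<longrightarrow> u \<bullet> e \<le> c * norm u * s" if "J \<subseteq> I" for J
  proof -
    have "finite (a ` J)"
      using that fin by (simp add: finite_subset)
    from cone_bounded_generation[OF this] obtain c where c: "c > 0"
      "\<And>u e s. \<lbrakk>u \<in> convex_cone hull (a ` J); 0 \<le> s; \<And>g. g \<in> a ` J \<Longrightarrow> g \<bullet> e \<le> s\<rbrakk>
           \<Longrightarrow> u \<bullet> e \<le> c * norm u * s"
      by blast
    show ?thesis
      by (intro exI[of _ c] conjI allI impI c) auto
  qed
  then have "\<forall>J\<in>Pow I. \<exists>c>0. \<forall>u e s. u \<in> convex_cone hull (a ` J) \<longrightarrow> 0 \<le> s \<longrightarrow> (\<forall>i\<in>J. a i \<bullet> e \<le> s)
          \<longrightarrow> u \<bullet> e \<le> c * norm u * s"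
    by simp
  then obtain c where "\<forall>J\<in>Pow I. c J > 0 \<and> (\<forall>u e s. u \<in> convex_cone hull (a ` J) \<longrightarrow> 0 \<le> s \<longrightarrow>
      (\<forall>i\<in>J. a i \<bullet> e \<le> s) \<longrightarrow> u \<bullet> e \<le> c J * norm u * s)"
    unfolding bchoice_iff by blast
  then have c: "\<And>J. J \<subseteq> I \<Longrightarrow> c J > 0"
    "\<And>J u e s. \<lbrakk>J \<subseteq> I; u \<in> convex_cone hull (a ` J); 0 \<le> s; \<forall>i\<in>J. a i \<bullet> e \<le> s\<rbrakk>
          \<Longrightarrow> u \<bullet> e \<le> c J * norm u * s"
    by simp_all
  let ?c = "Max (c ` Pow I)"
  have le: "c J \<le> ?c" if "J \<subseteq> I" for J
    using that fin by (intro Max_ge) auto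
  have poly: "polyhedron ?S"
    by (rule polyhedron_system[OF fin])
  have "?c > 0"
    using c(1)[of "{}"] le[of "{}"] by simp
  show thesis
  proof
    show "?c > 0" by fact
  next
    fix z s assume s: "0 \<le> s" and z: "\<forall>i\<in>I. a i \<bullet> z \<le> b i + s"
    define y where "y = closest_point ?S z"
    have yS: "y \<in> ?S"
      unfolding y_def using poly ne by (intro closest_point_in_set polyhedron_imp_closed)
    let ?J = "{i\<in>I. a i \<bullet> y = b i}"
    have "z - y \<in> convex_cone hull (a ` ?J)"
    proof (rule normal_cone_of_system[OF fin])
      show "\<forall>i\<in>I. a i \<bullet> y \<le> b i" using yS by simp
      show "(z - y) \<bullet> (x - y) \<le> 0" if "\<forall>i\<in>I. a i \<bullet> x \<le> b i" for x
        unfolding y_def using that poly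
        by (intro closest_point_dot polyhedron_imp_closed polyhedron_imp_convex) auto
    qed
    then have "(z - y) \<bullet> (z - y) \<le> c ?J * norm (z - y) * s"
      using z s by (intro c(2)) (auto simp: inner_diff_right)
    also have "\<dots> \<le> ?c * norm (z - y) * s"
      using le[of ?J] s by (intro mult_right_mono) auto
    finally have "norm (z - y) * norm (z - y) \<le> norm (z - y) * (?c * s)"
      by (simp add: dot_square_norm power2_eq_square algebra_simps)
    then have "norm (z - y) \<le> ?c * s"
      using s \<open>0 < ?c\<close> by (cases "z = y") auto
    then show "\<exists>y. (\<forall>i\<in>I. a i \<bullet> y \<le> b i) \<and> dist z y \<le> ?c * s"
      using yS by (auto simp: dist_norm)
  qed
qed

text \<open>
  Unlike Hoffman's bound, this covers inconsistent systems, where it says that the violation is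
  bounded away from zero.  That case reduces to the bound for the homogenised system
  \<open>a i \<bullet> z - b i * \<tau> \<le> 0\<close>, \<open>0 \<le> \<tau>\<close>, which is always solvable: a point \<open>z\<close> violating
  the original system only slightly gives a point \<open>(z, 1)\<close> close to a solution \<open>(z', \<tau>)\<close>
  with \<open>\<tau> > 0\<close>, and \<open>z' / \<tau>\<close> would solve the original system.
\<close>

lemma nearly_feasible_imp_near_feasible:
  fixes a :: "'i \<Rightarrow> 'a::euclidean_space"
  assumes fin: "finite I" and "\<epsilon> > 0"
  obtains \<delta> where "\<delta> > 0"
    and "\<And>z. \<forall>i\<in>I. a i \<bullet> z \<le> b i + \<delta> \<Longrightarrow> \<exists>y. (\<forall>i\<in>I. a i \<bullet> y \<le> b i) \<and> dist z y < \<epsilon>"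
proof (cases "{x. \<forall>i\<in>I. a i \<bullet> x \<le> b i} = {}")
  case False
  from hoffman_bound[OF fin this] obtain c where c: "c > 0"
    "\<And>z s. \<lbrakk>0 \<le> s; \<forall>i\<in>I. a i \<bullet> z \<le> b i + s\<rbrakk>
           \<Longrightarrow> \<exists>y. (\<forall>i\<in>I. a i \<bullet> y \<le> b i) \<and> dist z y \<le> c * s"
    by blast
  show thesis
  proof
    show "\<epsilon> / (2 * c) > 0" using \<open>\<epsilon> > 0\<close> c(1) by simp
    fix z assume "\<forall>i\<in>I. a i \<bullet> z \<le> b i + \<epsilon> / (2 * c)"
    then obtain y where "\<forall>i\<in>I. a i \<bullet> y \<le> b i" "dist z y \<le> c * (\<epsilon> / (2 * c))"
      using c(2) \<open>\<epsilon> / (2 * c) > 0\<close> less_imp_le by blast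
    then show "\<exists>y. (\<forall>i\<in>I. a i \<bullet> y \<le> b i) \<and> dist z y < \<epsilon>"
      using c(1) \<open>\<epsilon> > 0\<close> by (intro exI[of _ y]) auto
  qed
next
  case empty: True
  let ?I = "insert None (Some ` I)"
  \<comment> \<open>The index \<open>None\<close> carries the constraint that the homogenising variable is nonnegative.\<close>
  define a' where "a' = case_option (0::'a, -1::real) (\<lambda>i. (a i, - b i))"
  have "{x. \<forall>i\<in>?I. a' i \<bullet> x \<le> 0} \<noteq> {}"
  proof -
    have "(0 :: 'a \<times> real) \<in> {x. \<forall>i\<in>?I. a' i \<bullet> x \<le> 0}"
      by simp
    then show ?thesis by blast
  qed
  from hoffman_bound[OF _ this] fin obtain c where c: "c > 0"
    "\<And>z s. \<lbrakk>0 \<le> s; \<forall>i\<in>?I. a' i \<bullet> z \<le> 0 + s\<rbrakk>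
           \<Longrightarrow> \<exists>y. (\<forall>i\<in>?I. a' i \<bullet> y \<le> 0) \<and> dist z y \<le> c * s"
    by (metis (no_types) finite.insertI finite_imageI)
  show thesis
  proof
    show "1 / (2 * c) > 0" using c(1) by simp
    fix z assume "\<forall>i\<in>I. a i \<bullet> z \<le> b i + 1 / (2 * c)"
    moreover have "- 1 \<le> 1 / (2 * c)"
      by (rule order_trans[of _ 0]) (use c(1) in auto)
    ultimately have "\<forall>i\<in>?I. a' i \<bullet> (z, 1) \<le> 0 + 1 / (2 * c)"
      by (auto simp: a'_def)
    then obtain y where y: "\<forall>i\<in>?I. a' i \<bullet> y \<le> 0" and d: "dist (z, 1) y \<le> c * (1 / (2 * c))"
      using c(2) \<open>1 / (2 * c) > 0\<close> less_imp_le by blast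
    have "dist (1::real) (snd y) \<le> 1 / 2"
      using dist_snd_le[of "(z, 1)" y] d c(1) by simp
    then have pos: "snd y > 0" unfolding dist_real_def by linarith
    have "a i \<bullet> ((1 / snd y) *\<^sub>R fst y) \<le> b i" if "i \<in> I" for i
      using y that pos by (cases y) (auto simp: a'_def field_simps)
    then show "\<exists>y. (\<forall>i\<in>I. a i \<bullet> y \<le> b i) \<and> dist z y < \<epsilon>"
      using empty by blast
  qed
qed

text \<open>
  Being near \<open>P\<close> means violating its finitely many half-space constraints only slightly, and
  \<open>g\<close> pulls these back to a linear system in \<open>z\<close>.  Besides the distance estimate, this gives
  a way to prove that \<open>{y. g y + v \<in> P}\<close> is nonempty.
\<close>

lemma near_polyhedron_imp_near_affine_vimage:
  fixes g :: "'a::euclidean_space \<Rightarrow> 'b::euclidean_space"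
  assumes "polyhedron P" and g: "linear g" and "\<epsilon> > 0"
  obtains \<delta> where "\<delta> > 0"
    and "\<And>z p. \<lbrakk>p \<in> P; dist (g z + v) p < \<delta>\<rbrakk> \<Longrightarrow> \<exists>y. g y + v \<in> P \<and> dist z y < \<epsilon>"
proof -
  obtain F :: "'b set set" and a b where F: "finite F" "P = {x. \<forall>h\<in>F. a h \<bullet> x \<le> b h}"
    using polyhedron_halfspaces[OF assms(1)] by blast
  obtain \<delta> where \<delta>: "\<delta> > 0" "\<And>z. \<forall>h\<in>F. adjoint g (a h) \<bullet> z \<le> (b h - a h \<bullet> v) + \<delta> \<Longrightarrow>
      \<exists>y. (\<forall>h\<in>F. adjoint g (a h) \<bullet> y \<le> b h - a h \<bullet> v) \<and> dist z y < \<epsilon>"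
    using nearly_feasible_imp_near_feasible[OF F(1) \<open>\<epsilon> > 0\<close>,
        of "\<lambda>h. adjoint g (a h)" "\<lambda>h. b h - a h \<bullet> v"] by blast
  define N where "N = 1 + (\<Sum>h\<in>F. norm (a h))"
  have N: "norm (a h) \<le> N" if "h \<in> F" for h
    using that F(1) unfolding N_def
    by (auto intro!: add_increasing member_le_sum)
  have "N > 0" unfolding N_def by (auto intro!: add_pos_nonneg sum_nonneg)
  show thesis
  proof
    show "\<delta> / N > 0" using \<delta>(1) \<open>N > 0\<close> by simp
    fix z p assume p: "p \<in> P" "dist (g z + v) p < \<delta> / N"
    have "adjoint g (a h) \<bullet> z \<le> (b h - a h \<bullet> v) + \<delta>" if h: "h \<in> F" for h
    proof -
      have "a h \<bullet> (g z + v - p) \<le> norm (a h) * norm (g z + v - p)"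
        by (rule norm_cauchy_schwarz)
      also have "\<dots> \<le> N * (\<delta> / N)"
        using N[OF h] \<open>N > 0\<close> p(2) by (intro mult_mono) (auto simp: dist_norm)
      finally have "a h \<bullet> (g z + v) \<le> b h + \<delta>"
        using p(1) h \<open>N > 0\<close> by (auto simp: F(2) inner_diff_right)
      then show ?thesis
        by (simp add: affine_vimage_halfspaces[OF g])
    qed
    then show "\<exists>y. g y + v \<in> P \<and> dist z y < \<epsilon>"
      using \<delta>(2)[of z] by (simp add: F(2) affine_vimage_halfspaces[OF g])
  qed
qed

text \<open>
  The preimage of \<open>P \<times> R\<close> under the diagonal map is \<open>P \<inter> R\<close>; if \<open>P\<close> and \<open>R\<close> came
  arbitrarily close, the diagonal would come close to \<open>P \<times> R\<close> and so \<open>P \<inter> R\<close> would be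
  nonempty.
\<close>

lemma disjoint_polyhedra_apart:
  fixes P R :: "'a::euclidean_space set"
  assumes "polyhedron P" "polyhedron R" "P \<inter> R = {}"
  obtains \<delta> where "\<delta> > 0" and "\<And>p r. \<lbrakk>p \<in> P; r \<in> R\<rbrakk> \<Longrightarrow> dist p r \<ge> \<delta>"
proof -
  have "linear (\<lambda>y::'a. (y, y))"
    by (simp add: linear_iff)
  then show thesis
  proof (rule near_polyhedron_imp_near_affine_vimage[OF polyhedron_Times[OF assms(1,2)] _ zero_less_one,
        where v = 0])
    fix \<delta> :: real
    assume "\<delta> > 0"
      and \<delta>: "\<And>z p. \<lbrakk>p \<in> P \<times> R; dist ((z, z) + 0) p < \<delta>\<rbrakk> \<Longrightarrow> \<exists>y. (y, y) + 0 \<in> P \<times> R \<and> dist z y < 1"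
    have "dist p r \<ge> \<delta>" if pr: "p \<in> P" "r \<in> R" for p r
    proof (rule ccontr)
      assume "\<not> dist p r \<ge> \<delta>"
      then have "dist ((p, p) + 0) (p, r) < \<delta>"
        by (simp add: dist_Pair_Pair)
      from \<delta>[OF _ this] obtain y where "(y, y) + 0 \<in> P \<times> R"
        using pr by auto
      then show False
        using assms(3) by auto
    qed
    then show thesis
      using that \<open>\<delta> > 0\<close> by blast
  qed
qed

section \<open>Components of finite unions of polyhedra\<close>

lemma finite_union_polyhedra_component:
  fixes \<F> :: "'a::euclidean_space set set"
  assumes poly: "\<And>P. P \<in> \<F> \<Longrightarrow> polyhedron P" and "\<Omega> \<in> components (\<Union>\<F>)"
  shows "\<Omega> = \<Union>{P\<in>\<F>. P \<subseteq> \<Omega>}"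
proof
  show "\<Omega> \<subseteq> \<Union>{P\<in>\<F>. P \<subseteq> \<Omega>}"
  proof
    fix p assume "p \<in> \<Omega>"
    then obtain P where "P \<in> \<F>" "p \<in> P"
      using in_components_subset[OF assms(2)] by blast
    moreover from this have "P \<subseteq> \<Omega>"
      using poly \<open>p \<in> \<Omega>\<close> assms(2)
      by (intro components_maximal[OF assms(2)] convex_connected polyhedron_imp_convex) auto
    ultimately show "p \<in> \<Union>{P\<in>\<F>. P \<subseteq> \<Omega>}"
      by blast
  qed
qed blast

text \<open>
  Members of \<open>\<F>\<close> that meet lie in the same component because they are convex, so points of
  different components come from disjoint members, of which there are finitely many pairs.
\<close>

lemma finite_union_polyhedra_components_apart:
  fixes \<F> :: "'a::euclidean_space set set"
  assumes fin: "finite \<F>" and poly: "\<And>P. P \<in> \<F> \<Longrightarrow> polyhedron P"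
  obtains \<delta> where "\<delta> > 0"
    and "\<And>\<Omega> p r. \<lbrakk>\<Omega> \<in> components (\<Union>\<F>); p \<in> \<Omega>; r \<in> \<Union>\<F> - \<Omega>\<rbrakk> \<Longrightarrow> \<delta> \<le> dist p r"
proof -
  have "\<forall>X\<in>\<F> \<times> \<F>. \<exists>\<delta>>0. fst X \<inter> snd X = {} \<longrightarrow> (\<forall>p\<in>fst X. \<forall>r\<in>snd X. \<delta> \<le> dist p r)"
  proof
    fix X assume X: "X \<in> \<F> \<times> \<F>"
    show "\<exists>\<delta>>0. fst X \<inter> snd X = {} \<longrightarrow> (\<forall>p\<in>fst X. \<forall>r\<in>snd X. \<delta> \<le> dist p r)"
    proof (cases "fst X \<inter> snd X = {}")
      case True
      have "polyhedron (fst X)" "polyhedron (snd X)"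
        using X poly by auto
      from disjoint_polyhedra_apart[OF this True]
      obtain \<delta> where "\<delta> > 0" "\<And>p r. \<lbrakk>p \<in> fst X; r \<in> snd X\<rbrakk> \<Longrightarrow> \<delta> \<le> dist p r"
        by blast
      then show ?thesis
        by (intro exI[of _ \<delta>]) simp
    qed (auto intro: exI[of _ 1])
  qed
  then obtain d where "\<forall>X\<in>\<F> \<times> \<F>. d X > 0 \<and>
      (fst X \<inter> snd X = {} \<longrightarrow> (\<forall>p\<in>fst X. \<forall>r\<in>snd X. d X \<le> dist p r))"
    unfolding bchoice_iff by (elim exE)
  then have d: "\<And>X. X \<in> \<F> \<times> \<F> \<Longrightarrow> d X > 0"
    "\<And>X p r. \<lbrakk>X \<in> \<F> \<times> \<F>; fst X \<inter> snd X = {}; p \<in> fst X; r \<in> snd X\<rbrakk> \<Longrightarrow> d X \<le> dist p r"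
    by blast+
  let ?\<delta> = "Min (insert 1 (d ` (\<F> \<times> \<F>)))"
  show thesis
  proof
    show "?\<delta> > 0"
      using fin d(1) by (subst Min_gr_iff) auto
  next
    fix \<Omega> p r assume \<Omega>: "\<Omega> \<in> components (\<Union>\<F>)" and p: "p \<in> \<Omega>" and r: "r \<in> \<Union>\<F> - \<Omega>"
    obtain P where P: "P \<in> \<F>" "P \<subseteq> \<Omega>" "p \<in> P"
      using finite_union_polyhedra_component[OF poly \<Omega>] p by blast
    obtain R where R: "R \<in> \<F>" "r \<in> R"
      using r by blast
    have "\<Omega> \<inter> R = {}"
    proof (rule ccontr)
      assume "\<Omega> \<inter> R \<noteq> {}"
      then have "R \<subseteq> \<Omega>"
        using R(1) by (intro components_maximal[OF \<Omega>] convex_connected polyhedron_imp_convex poly) auto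
      then show False using r R(2) by blast
    qed
    then have "d (P, R) \<le> dist p r"
      using P R by (intro d(2)[of "(P, R)"]) auto
    moreover have "?\<delta> \<le> d (P, R)"
      using fin P(1) R(1) by (intro Min_le) auto
    ultimately show "?\<delta> \<le> dist p r" by simp
  qed
qed

lemma tendsto_infdist_zero:
  assumes "\<And>\<epsilon>. \<epsilon> > 0 \<Longrightarrow> \<forall>\<^sub>F t in F. \<exists>y\<in>S. dist (x t) y < \<epsilon>"
  shows "((\<lambda>t. infdist (x t) S) \<longlongrightarrow> 0) F"
proof (rule tendstoI)
  fix \<epsilon> :: real assume "\<epsilon> > 0"
  show "\<forall>\<^sub>F t in F. dist (infdist (x t) S) 0 < \<epsilon>"
    using assms[OF \<open>\<epsilon> > 0\<close>]
  proof eventually_elim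
    case (elim t)
    then obtain y where "y \<in> S" "dist (x t) y < \<epsilon>" by blast
    then have "infdist (x t) S < \<epsilon>"
      using infdist_le[of y S "x t"] by simp
    then show ?case
      by (simp add: infdist_nonneg)
  qed
qed

text \<open>
  Late points of the path stay within the \<open>\<delta> / 2\<close>-neighbourhood of \<open>S\<close>.  By the separation
  of the components, this neighbourhood splits into two disjoint open sets, one around a given
  component and one around the rest, and the connected tail of the path cannot visit both.
\<close>

lemma path_selects_component:
  fixes x :: "real \<Rightarrow> 'a::euclidean_space"
  assumes cont: "continuous_on {0..} x"
    and near: "\<And>\<epsilon>. \<epsilon> > 0 \<Longrightarrow> \<forall>\<^sub>F t in at_top. \<exists>y\<in>S. dist (x t) y < \<epsilon>"
    and "\<delta> > 0"
    and apart: "\<And>\<Omega> p r. \<lbrakk>\<Omega> \<in> components S; p \<in> \<Omega>; r \<in> S - \<Omega>\<rbrakk> \<Longrightarrow> \<delta> \<le> dist p r"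
  obtains \<Omega> where "\<Omega> \<in> components S"
    and "\<And>\<epsilon>. \<epsilon> > 0 \<Longrightarrow> \<forall>\<^sub>F t in at_top. \<exists>y\<in>\<Omega>. dist (x t) y < \<epsilon>"
proof -
  have "\<forall>\<^sub>F t in at_top. 0 \<le> t \<and> (\<exists>y\<in>S. dist (x t) y < \<delta> / 2)"
    using near[of "\<delta> / 2"] \<open>\<delta> > 0\<close> by (intro eventually_conj eventually_ge_at_top) auto
  then obtain T where T: "\<And>t. t \<ge> T \<Longrightarrow> 0 \<le> t \<and> (\<exists>y\<in>S. dist (x t) y < \<delta> / 2)"
    unfolding eventually_at_top_linorder by blast
  then obtain y where y: "y \<in> S" "dist (x T) y < \<delta> / 2"
    by blast
  then obtain \<Omega> where \<Omega>: "\<Omega> \<in> components S" "y \<in> \<Omega>"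
    by (metis UnionE Union_components)
  define U V where "U = (\<Union>p\<in>\<Omega>. ball p (\<delta> / 2))" and "V = (\<Union>p\<in>S - \<Omega>. ball p (\<delta> / 2))"
  have "U \<inter> V = {}"
  proof (rule ccontr)
    assume "U \<inter> V \<noteq> {}"
    then obtain z where "z \<in> U" "z \<in> V"
      by blast
    then obtain p r where "p \<in> \<Omega>" "r \<in> S - \<Omega>" "dist p z < \<delta> / 2" "dist r z < \<delta> / 2"
      unfolding U_def V_def UN_iff mem_ball by blast
    moreover from this have "dist p r < \<delta>"
      using dist_triangle[of p r z] by (simp add: dist_commute)
    ultimately show False
      using apart[OF \<Omega>(1)] by fastforce
  qed
  have "open U" "open V"
    unfolding U_def V_def by auto
  have conn: "connected (x ` {T..})"
    using T by (intro connected_continuous_image continuous_on_subset[OF cont]) auto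
  have cover: "x ` {T..} \<subseteq> U \<union> V"
  proof
    fix z assume "z \<in> x ` {T..}"
    then obtain p where "p \<in> S" "dist p z < \<delta> / 2"
      using T by (force simp: dist_commute)
    then show "z \<in> U \<union> V"
      unfolding U_def V_def by auto
  qed
  have "x T \<in> U"
    unfolding U_def using y \<Omega>(2) by (auto simp: dist_commute)
  then have "V \<inter> x ` {T..} = {}"
    using connectedD[OF conn \<open>open U\<close> \<open>open V\<close> _ cover] \<open>U \<inter> V = {}\<close> by auto
  then have notV: "x t \<notin> V" if "t \<ge> T" for t
    using that by auto
  show thesis
  proof
    show "\<Omega> \<in> components S" by fact
    fix \<epsilon> :: real assume "\<epsilon> > 0"
    have "\<forall>\<^sub>F t in at_top. t \<ge> T \<and> (\<exists>y\<in>S. dist (x t) y < min \<epsilon> (\<delta> / 2))"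
      using near[of "min \<epsilon> (\<delta> / 2)"] \<open>\<epsilon> > 0\<close> \<open>\<delta> > 0\<close>
      by (intro eventually_conj eventually_ge_at_top) auto
    then show "\<forall>\<^sub>F t in at_top. \<exists>y\<in>\<Omega>. dist (x t) y < \<epsilon>"
    proof eventually_elim
      case (elim t)
      then obtain y where y: "y \<in> S" "dist (x t) y < \<epsilon>" "dist (x t) y < \<delta> / 2"
        by auto
      then have "y \<in> \<Omega>"
        using notV[of t] elim unfolding V_def by (auto simp: dist_commute)
      with y show ?case by blast
    qed
  qed
qed

section \<open>Vanishing of the residual along trajectories\<close>

text \<open>
  A replacement for Barbalat's lemma that works for unbounded trajectories.  Since \<open>r\<close> is
  Lipschitz in the state and drives the state, it changes by at most a fixed fraction of its size
  during a time \<open>h\<close> that depends only on \<open>k\<close> and \<open>L\<close>.  Hence over \<open>[u, u + h]\<close> the energy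
  \<open>\<phi>\<close> drops by at least a constant multiple of \<open>norm (r u) ^ 2\<close>; as \<open>\<phi>\<close> is decreasing and
  bounded below, these drops tend to zero.
\<close>

lemma residual_vanishes_by_energy_decay:
  fixes x r :: "real \<Rightarrow> 'a::euclidean_space"
  assumes "k > 0" "c > 0" "L > 0"
    and x': "\<And>t. t \<ge> 0 \<Longrightarrow> (x has_vector_derivative k *\<^sub>R r t) (at t within {0..})"
    and lip: "\<And>s t. \<lbrakk>s \<ge> 0; t \<ge> 0\<rbrakk> \<Longrightarrow> norm (r s - r t) \<le> L * norm (x s - x t)"
    and \<phi>': "\<And>t. t \<ge> 0 \<Longrightarrow> (\<phi> has_real_derivative \<phi>' t) (at t within {0..})"
    and decay: "\<And>t. t \<ge> 0 \<Longrightarrow> \<phi>' t \<le> - c * (norm (r t))\<^sup>2"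
    and bdd: "bdd_below (\<phi> ` {0..})"
  shows "(r \<longlongrightarrow> 0) at_top"
proof -
  \<comment> \<open>With this step length the residual varies by at most a quarter of its maximum.\<close>
  define h where "h = 1 / (4 * k * L)"
  have "h > 0" unfolding h_def using assms(1,3) by simp
  have drop: "\<phi> v - \<phi> u \<le> - m * (v - u)"
    if "0 \<le> u" "u < v" and m: "\<And>s. \<lbrakk>u \<le> s; s \<le> v\<rbrakk> \<Longrightarrow> \<phi>' s \<le> - m" for u v m
  proof -
    have "(\<phi> has_derivative (*) (\<phi>' s)) (at s within {u..v})" if "u \<le> s" "s \<le> v" for s
      using \<phi>'[of s] that \<open>0 \<le> u\<close>
      unfolding has_field_derivative_def by (auto elim: has_derivative_subset)
    from mvt_simple[OF \<open>u < v\<close> this] obtain s where s: "s \<in> {u<..<v}" "\<phi> v - \<phi> u = \<phi>' s * (v - u)"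
      by blast
    then show ?thesis
      using mult_right_mono[OF m[of s], of "v - u"] \<open>u < v\<close> by simp
  qed
  have x_cont: "continuous_on {0..} x"
    unfolding continuous_on_eq_continuous_within
    using has_vector_derivative_continuous[OF x'] by simp
  have r_cont: "continuous_on {0..} r"
    unfolding continuous_on_def
  proof
    fix t :: real assume t: "t \<in> {0..}"
    have "((\<lambda>s. L * norm (x s - x t)) \<longlongrightarrow> L * norm (x t - x t)) (at t within {0..})"
      using x_cont t by (intro tendsto_intros) (auto simp: continuous_on_def)
    then have "((\<lambda>s. r s - r t) \<longlongrightarrow> 0) (at t within {0..})"
      using lip t by (intro Lim_null_comparison[of "\<lambda>s. r s - r t" "\<lambda>s. L * norm (x s - x t)"])
        (auto simp: eventually_at_filter)
    then show "(r \<longlongrightarrow> r t) (at t within {0..})"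
      by (simp add: LIM_zero_iff)
  qed
  have key: "(norm (r u))\<^sup>2 \<le> 9 / (4 * c * h) * (\<phi> u - \<phi> (u + h))" if "u \<ge> 0" for u
  proof -
    have "continuous_on {u..u + h} (\<lambda>t. norm (r t))"
      using \<open>u \<ge> 0\<close> by (intro continuous_on_norm continuous_on_subset[OF r_cont]) auto
    then obtain s0 where s0: "s0 \<in> {u..u + h}" and max: "\<And>s. s \<in> {u..u + h} \<Longrightarrow> norm (r s) \<le> norm (r s0)"
      using continuous_attains_sup[of "{u..u + h}" "\<lambda>t. norm (r t)"] \<open>h > 0\<close> by auto
    have close: "norm (r s - r u) \<le> norm (r s0) / 4" if s: "s \<in> {u..u + h}" for s
    proof -
      have "norm (x s - x u) \<le> (k * norm (r s0)) * norm (s - u)"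
      proof (rule differentiable_bound[of "{u..u + h}" x "\<lambda>t d. d *\<^sub>R (k *\<^sub>R r t)"])
        fix t assume t: "t \<in> {u..u + h}"
        show "(x has_derivative (\<lambda>d. d *\<^sub>R (k *\<^sub>R r t))) (at t within {u..u + h})"
          using x'[of t] t \<open>u \<ge> 0\<close>
          unfolding has_vector_derivative_def by (auto elim: has_derivative_subset)
        show "onorm (\<lambda>d. d *\<^sub>R (k *\<^sub>R r t)) \<le> k * norm (r s0)"
          using max[OF t] \<open>k > 0\<close> by (intro onorm_le) (simp add: abs_mult mult.commute mult_left_mono)
      qed (use s \<open>h > 0\<close> in auto)
      also have "\<dots> \<le> (k * norm (r s0)) * h"
        using s \<open>k > 0\<close> by (intro mult_left_mono) auto
      finally have "L * norm (x s - x u) \<le> L * ((k * norm (r s0)) * h)"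
        using \<open>L > 0\<close> by simp
      also have "\<dots> = norm (r s0) / 4"
        unfolding h_def using \<open>k > 0\<close> \<open>L > 0\<close> by simp
      finally show ?thesis
        using lip[of s u] s \<open>u \<ge> 0\<close> by force
    qed
    have "norm (r s0) \<le> norm (r u) + norm (r s0) / 4"
      using close[OF s0] norm_triangle_ineq2[of "r s0" "r u"] by linarith
    then have lower: "2 / 3 * norm (r u) \<le> norm (r s)" if "s \<in> {u..u + h}" for s
      using close[OF that] norm_triangle_ineq3[of "r s" "r u"] by linarith
    have "\<phi>' s \<le> - (c * (2 / 3 * norm (r u))\<^sup>2)" if "u \<le> s" "s \<le> u + h" for s
    proof -
      have "c * (2 / 3 * norm (r u))\<^sup>2 \<le> c * (norm (r s))\<^sup>2"
        using lower[of s] that \<open>c > 0\<close> by (intro mult_left_mono power_mono) auto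
      then show ?thesis
        using decay[of s] that \<open>u \<ge> 0\<close> by simp
    qed
    then have "\<phi> (u + h) - \<phi> u \<le> - (c * (2 / 3 * norm (r u))\<^sup>2) * (u + h - u)"
      using \<open>u \<ge> 0\<close> \<open>h > 0\<close> by (intro drop) auto
    then show ?thesis
      using \<open>c > 0\<close> \<open>h > 0\<close> by (simp add: field_simps power2_eq_square)
  qed
  have anti: "\<phi> v \<le> \<phi> u" if "0 \<le> u" "u \<le> v" for u v
  proof (cases "u = v")
    case False
    have "\<phi> v - \<phi> u \<le> - 0 * (v - u)"
    proof (rule drop)
      fix s assume "u \<le> s" "s \<le> v"
      have "0 \<le> c * (norm (r s))\<^sup>2" using \<open>c > 0\<close> by simp
      then show "\<phi>' s \<le> - 0"
        using decay[of s] \<open>0 \<le> u\<close> \<open>u \<le> s\<close> by simp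
    qed (use that False in auto)
    then show ?thesis by simp
  qed simp
  show ?thesis
  proof (rule tendstoI)
    fix \<epsilon> :: real assume "\<epsilon> > 0"
    let ?l = "Inf (\<phi> ` {0..})"
    define \<gamma> where "\<gamma> = \<epsilon>\<^sup>2 * (4 * c * h) / 9"
    have "\<gamma> > 0" unfolding \<gamma>_def using \<open>\<epsilon> > 0\<close> \<open>c > 0\<close> \<open>h > 0\<close> by simp
    obtain T where T: "T \<ge> 0" "\<phi> T < ?l + \<gamma>"
      using cInf_lessD[of "\<phi> ` {0..}" "?l + \<gamma>"] \<open>\<gamma> > 0\<close> by auto
    have "norm (r t) < \<epsilon>" if "t \<ge> T" for t
    proof -
      have "?l \<le> \<phi> (t + h)"
        using T(1) that \<open>h > 0\<close> by (intro cInf_lower[OF _ bdd]) auto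
      moreover have "\<phi> t \<le> \<phi> T"
        using T(1) that by (rule anti)
      ultimately have "\<phi> t - \<phi> (t + h) < \<gamma>"
        using T(2) by linarith
      then have "9 / (4 * c * h) * (\<phi> t - \<phi> (t + h)) < 9 / (4 * c * h) * \<gamma>"
        using \<open>c > 0\<close> \<open>h > 0\<close> by (intro mult_strict_left_mono) auto
      also have "\<dots> = \<epsilon>\<^sup>2"
        unfolding \<gamma>_def using \<open>c > 0\<close> \<open>h > 0\<close> by simp
      finally have "(norm (r t))\<^sup>2 < \<epsilon>\<^sup>2"
        using key[of t] T(1) that by linarith
      then show ?thesis
        using \<open>\<epsilon> > 0\<close> by (simp add: power_less_imp_less_base)
    qed
    then show "\<forall>\<^sub>F t in at_top. dist (r t) 0 < \<epsilon>"
      unfolding eventually_at_top_linorder by (auto simp: dist_norm)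
  qed
qed

section \<open>The set of KKT points as a finite union of polyhedra\<close>

definition active_face :: "real^'n^'m \<Rightarrow> real^'m \<Rightarrow> 'm set \<Rightarrow> (real^'n) set" where
  "active_face A b I = {y \<in> feasible A b. \<forall>i\<in>I. (A *v y) $ i = b $ i}"

definition active_cone :: "real^'n^'m \<Rightarrow> 'm set \<Rightarrow> (real^'n) set" where
  "active_cone A I = convex_cone hull ((\<lambda>i. A $ i) ` I)"

text \<open>
  The multiplier is eliminated by asking that the gradient lie in the cone of the rows in
  \<open>I\<close>.  This makes the piece a preimage of a polyhedron under an affine map, so that no
  projection of a polyhedron along the multiplier variables is involved.
\<close>

definition KKT_piece ::
    "real^'n^'n \<Rightarrow> real^'n \<Rightarrow> real^'n^'m \<Rightarrow> real^'m \<Rightarrow> 'm set \<Rightarrow> (real^'n) set" where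
  "KKT_piece Q q A b I = {y \<in> active_face A b I. Q *v y + q \<in> active_cone A I}"

lemma feasible_system: "feasible A b = {y. \<forall>i\<in>UNIV. - (A $ i) \<bullet> y \<le> - (b $ i)}"
  by (auto simp: feasible_def less_eq_vec_def matrix_vector_mul_component)

lemma polyhedron_feasible: "polyhedron (feasible A b)"
  unfolding feasible_system by (rule polyhedron_system) simp

lemma polyhedron_active_face: "polyhedron (active_face A b I)"
proof -
  have "active_face A b I = feasible A b \<inter> {y. \<forall>i\<in>I. A $ i \<bullet> y \<le> b $ i}"
    by (auto simp: active_face_def feasible_def less_eq_vec_def matrix_vector_mul_component
        intro: antisym)
  then show ?thesis
    by (simp add: polyhedron_feasible polyhedron_system)
qed

lemma polyhedron_active_cone: "polyhedron (active_cone A I)"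
  unfolding active_cone_def by (rule polyhedron_convex_cone_hull) simp

lemma polyhedron_KKT_piece: "polyhedron (KKT_piece Q q A b I)"
proof -
  have "KKT_piece Q q A b I = active_face A b I \<inter> {y. Q *v y + q \<in> active_cone A I}"
    by (auto simp: KKT_piece_def)
  then show ?thesis
    by (simp add: polyhedron_active_face polyhedron_active_cone polyhedron_affine_vimage)
qed

lemma transpose_mult_eq_row_sum:
  fixes A :: "real^'n^'m"
  shows "transpose A *v l = (\<Sum>i\<in>UNIV. l $ i *\<^sub>R A $ i)"
  using matrix_vector_column[of "transpose A" l]
  by (simp only: transpose_transpose scalar_mult_eq_scaleR)

text \<open>
  For a KKT point take \<open>I\<close> to be the support of its multiplier; complementarity makes these
  constraints tight.  Conversely a conic representation of the gradient over tight rows, extended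
  by zero, is a multiplier.
\<close>

lemma KKT_points_eq_pieces: "KKT_points Q q A b = (\<Union>I. KKT_piece Q q A b I)"
proof (intro set_eqI iffI)
  fix x assume "x \<in> KKT_points Q q A b"
  then obtain l where stat: "Q *v x + q - transpose A *v l = 0" and feas: "A *v x \<ge> b"
    and l0: "l \<ge> 0" and compl: "l \<bullet> (A *v x - b) = 0"
    unfolding KKT_points_def by blast
  let ?I = "{i. 0 < l $ i}"
  have nonneg: "0 \<le> l $ i" "b $ i \<le> (A *v x) $ i" for i
    using l0 feas by (auto simp: less_eq_vec_def)
  have "(\<Sum>i\<in>UNIV. l $ i * ((A *v x) $ i - b $ i)) = 0"
    using compl by (simp add: inner_vec_def)
  then have "\<forall>i\<in>UNIV. l $ i * ((A *v x) $ i - b $ i) = 0"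
    by (subst (asm) sum_nonneg_eq_0_iff) (auto intro!: mult_nonneg_nonneg simp: nonneg)
  then have "x \<in> active_face A b ?I"
    using feas by (force simp: active_face_def feasible_def)
  moreover have "Q *v x + q = (\<Sum>i\<in>?I. l $ i *\<^sub>R A $ i)"
  proof -
    have "Q *v x + q = (\<Sum>i\<in>UNIV. l $ i *\<^sub>R A $ i)"
      using stat by (simp only: transpose_mult_eq_row_sum[symmetric] right_minus_eq)
    also have "\<dots> = (\<Sum>i\<in>?I. l $ i *\<^sub>R A $ i)"
      by (rule sum.mono_neutral_right) (use nonneg in \<open>auto simp: not_less intro: antisym\<close>)
    finally show ?thesis .
  qed
  then have "Q *v x + q \<in> active_cone A ?I"
    unfolding active_cone_def
    by (subst convex_cone_hull_image_explicit) (auto intro!: exI[of _ "\<lambda>i. l $ i"])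
  ultimately show "x \<in> (\<Union>I. KKT_piece Q q A b I)"
    by (auto simp: KKT_piece_def)
next
  fix x assume "x \<in> (\<Union>I. KKT_piece Q q A b I)"
  then obtain I where face: "x \<in> active_face A b I" and "Q *v x + q \<in> active_cone A I"
    by (auto simp: KKT_piece_def)
  then obtain m where m: "\<forall>i\<in>I. 0 \<le> m i" "Q *v x + q = (\<Sum>i\<in>I. m i *\<^sub>R A $ i)"
    unfolding active_cone_def by (subst (asm) convex_cone_hull_image_explicit) auto
  define l where "l = (\<chi> i. if i \<in> I then m i else 0)"
  have "(\<Sum>i\<in>I. m i *\<^sub>R A $ i) = (\<Sum>i\<in>UNIV. l $ i *\<^sub>R A $ i)"
    by (rule sum.mono_neutral_cong_left) (auto simp: l_def)
  then have "Q *v x + q - transpose A *v l = 0"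
    by (simp only: m(2) transpose_mult_eq_row_sum diff_self)
  moreover have "l \<ge> 0"
    using m(1) by (auto simp: l_def less_eq_vec_def)
  moreover have "l \<bullet> (A *v x - b) = 0"
    using face by (auto simp: l_def inner_vec_def active_face_def intro!: sum.neutral)
  moreover have "A *v x \<ge> b"
    using face by (simp add: active_face_def feasible_def)
  ultimately show "x \<in> KKT_points Q q A b"
    unfolding KKT_points_def by blast
qed

text \<open>
  The Farkas form of the optimality condition for the projection.  It says that the projected point
  satisfies the KKT system up to a perturbation of the gradient that is proportional to the
  residual \<open>p - x\<close>.
\<close>

lemma projected_gradient_step_multipliers:
  fixes A :: "real^'n^'m"
  assumes "feasible A b \<noteq> {}" and "\<rho> > 0"
    and p: "p = closest_point (feasible A b) (x - (1/\<rho>) *\<^sub>R g)"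
  obtains I where "p \<in> active_face A b I" and "\<rho> *\<^sub>R (p - x) + g \<in> active_cone A I"
proof -
  let ?C = "feasible A b"
  let ?I = "{i\<in>UNIV. - (A $ i) \<bullet> p = - (b $ i)}"
  have C: "closed ?C" "convex ?C"
    using polyhedron_feasible by (auto intro: polyhedron_imp_closed polyhedron_imp_convex)
  have pC: "p \<in> ?C"
    unfolding p using C(1) assms(1) by (rule closest_point_in_set)
  have "x - (1/\<rho>) *\<^sub>R g - p \<in> convex_cone hull ((\<lambda>i. - (A $ i)) ` ?I)"
  proof (rule normal_cone_of_system)
    show "\<forall>i\<in>UNIV. - (A $ i) \<bullet> p \<le> - (b $ i)"
      using pC unfolding feasible_system by blast
    fix z assume "\<forall>i\<in>UNIV. - (A $ i) \<bullet> z \<le> - (b $ i)"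
    then have "z \<in> ?C"
      unfolding feasible_system by blast
    then show "(x - (1/\<rho>) *\<^sub>R g - p) \<bullet> (z - p) \<le> 0"
      unfolding p by (rule closest_point_dot[OF C(2,1)])
  qed simp
  then obtain m where m: "\<forall>i\<in>?I. 0 \<le> m i"
    and eq: "x - (1/\<rho>) *\<^sub>R g - p = (\<Sum>i\<in>?I. m i *\<^sub>R - (A $ i))"
    by (subst (asm) convex_cone_hull_image_explicit) auto
  have "\<rho> *\<^sub>R (p - x) + g = (- \<rho>) *\<^sub>R (x - (1/\<rho>) *\<^sub>R g - p)"
    using \<open>\<rho> > 0\<close> by (simp add: algebra_simps)
  also have "\<dots> = (\<Sum>i\<in>?I. (\<rho> * m i) *\<^sub>R A $ i)"
    unfolding eq by (simp add: scaleR_sum_right sum_negf)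
  finally have "\<rho> *\<^sub>R (p - x) + g \<in> active_cone A ?I"
    unfolding active_cone_def using m \<open>\<rho> > 0\<close>
    by (subst convex_cone_hull_image_explicit) (auto intro!: exI[of _ "\<lambda>i. \<rho> * m i"])
  moreover have "p \<in> active_face A b ?I"
    using pC by (auto simp: active_face_def matrix_vector_mul_component)
  ultimately show thesis
    using that by blast
qed

text \<open>
  A qualitative version of the Luo--Tseng error bound, valid on unbounded sets.  With
  \<open>p\<close> the projected point, \<open>(p, Q p + q)\<close> is close to \<open>active_face A b I \<times> active_cone A I\<close>
  for some \<open>I\<close>, and the preimage of this polyhedron under \<open>y \<mapsto> (y, Q y + q)\<close> is a piece
  of the KKT set.  The threshold is uniform since there are finitely many \<open>I\<close>.  In particular
  KKT points exist as soon as arbitrarily small residuals do.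
\<close>

lemma small_residual_imp_near_KKT:
  fixes Q :: "real^'n^'n" and A :: "real^'n^'m"
  assumes ne: "feasible A b \<noteq> {}" and "\<rho> > 0" and "\<epsilon> > 0"
  shows "\<exists>\<delta>>0. \<forall>x. norm (closest_point (feasible A b) (x - (1/\<rho>) *\<^sub>R (Q *v x + q)) - x) < \<delta>
           \<longrightarrow> (\<exists>y\<in>KKT_points Q q A b. dist x y < \<epsilon>)"
proof -
  have lin: "linear (\<lambda>y. (y, Q *v y))"
    by (simp add: linear_iff matrix_vector_right_distrib matrix_vector_mult_scaleR)
  have "\<exists>\<delta>>0. \<forall>z p. p \<in> active_face A b I \<times> active_cone A I \<longrightarrow> dist ((z, Q *v z) + (0, q)) p < \<delta> \<longrightarrow>
      (\<exists>y. (y, Q *v y) + (0, q) \<in> active_face A b I \<times> active_cone A I \<and> dist z y < \<epsilon> / 2)" for I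
  proof -
    have "\<epsilon> / 2 > 0" using \<open>\<epsilon> > 0\<close> by simp
    then show ?thesis
    proof (rule near_polyhedron_imp_near_affine_vimage[OF
          polyhedron_Times[OF polyhedron_active_face[of A b I] polyhedron_active_cone[of A I]] lin,
          where v = "(0, q)"])
      fix \<delta> :: real
      assume "\<delta> > 0" and "\<And>z p. \<lbrakk>p \<in> active_face A b I \<times> active_cone A I;
          dist ((z, Q *v z) + (0, q)) p < \<delta>\<rbrakk> \<Longrightarrow>
        \<exists>y. (y, Q *v y) + (0, q) \<in> active_face A b I \<times> active_cone A I \<and> dist z y < \<epsilon> / 2"
      then show ?thesis
        by (intro exI[of _ \<delta>]) simp
    qed
  qed
  then have "\<forall>I. \<exists>\<delta>>0. \<forall>z p. p \<in> active_face A b I \<times> active_cone A I \<longrightarrow> dist ((z, Q *v z) + (0, q)) p < \<delta> \<longrightarrow>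
      (\<exists>y. (y, Q *v y) + (0, q) \<in> active_face A b I \<times> active_cone A I \<and> dist z y < \<epsilon> / 2)"
    by (rule allI)
  then obtain d where "\<forall>I. d I > 0 \<and> (\<forall>z p. p \<in> active_face A b I \<times> active_cone A I \<longrightarrow>
      dist ((z, Q *v z) + (0, q)) p < d I \<longrightarrow>
      (\<exists>y. (y, Q *v y) + (0, q) \<in> active_face A b I \<times> active_cone A I \<and> dist z y < \<epsilon> / 2))"
    unfolding choice_iff by (elim exE)
  then have dpos: "d I > 0"
    and d: "\<lbrakk>p \<in> active_face A b I \<times> active_cone A I; dist ((z, Q *v z) + (0, q)) p < d I\<rbrakk> \<Longrightarrow>
      \<exists>y. (y, Q *v y) + (0, q) \<in> active_face A b I \<times> active_cone A I \<and> dist z y < \<epsilon> / 2" for I z p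
    by blast+
  define \<gamma> where "\<gamma> = Min (range d)"
  have "\<gamma> > 0"
    unfolding \<gamma>_def using dpos by (subst Min_gr_iff) auto
  have \<gamma>: "\<gamma> \<le> d I" for I
    unfolding \<gamma>_def by (rule Min_le) auto
  obtain K where K: "K > 0" "\<And>v. norm (Q *v v) \<le> norm v * K"
    using bounded_linear.pos_bounded[OF matrix_vector_mul_bounded_linear[of Q]] by blast
  show ?thesis
  proof (intro exI conjI allI impI)
    show "min (\<epsilon> / 2) (\<gamma> / (K + \<rho>)) > 0"
      using \<open>\<epsilon> > 0\<close> \<open>\<gamma> > 0\<close> \<open>\<rho> > 0\<close> K(1) by simp
    fix x
    define p where "p = closest_point (feasible A b) (x - (1/\<rho>) *\<^sub>R (Q *v x + q))"
    assume "norm (closest_point (feasible A b) (x - (1/\<rho>) *\<^sub>R (Q *v x + q)) - x)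
        < min (\<epsilon> / 2) (\<gamma> / (K + \<rho>))"
    then have small: "norm (p - x) < \<epsilon> / 2" "norm (p - x) < \<gamma> / (K + \<rho>)"
      by (simp_all add: p_def)
    let ?w = "\<rho> *\<^sub>R (p - x) + (Q *v x + q)"
    obtain I where I: "p \<in> active_face A b I" "?w \<in> active_cone A I"
      using projected_gradient_step_multipliers[OF ne \<open>\<rho> > 0\<close> p_def] by blast
    have "dist ((p, Q *v p) + (0, q)) (p, ?w) = norm (Q *v (p - x) - \<rho> *\<^sub>R (p - x))"
      by (simp add: dist_Pair_Pair dist_norm matrix_vector_mult_diff_distrib algebra_simps)
    also have "\<dots> \<le> norm (Q *v (p - x)) + norm (\<rho> *\<^sub>R (p - x))"
      by (rule norm_triangle_ineq4)
    also have "\<dots> \<le> norm (p - x) * (K + \<rho>)"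
    proof -
      have "norm (\<rho> *\<^sub>R (p - x)) = norm (p - x) * \<rho>"
        using \<open>\<rho> > 0\<close> by (simp add: mult.commute)
      then show ?thesis
        using K(2)[of "p - x"] by (simp only: distrib_left)
    qed
    also have "\<dots> < \<gamma>"
      using small(2) K(1) \<open>\<rho> > 0\<close> by (simp add: pos_less_divide_eq)
    also have "\<dots> \<le> d I" by (rule \<gamma>)
    finally have "dist ((p, Q *v p) + (0, q)) (p, ?w) < d I" .
    from d[OF _ this] I obtain y where y: "(y, Q *v y) + (0, q) \<in> active_face A b I \<times> active_cone A I"
      "dist p y < \<epsilon> / 2"
      by auto
    have "y \<in> KKT_points Q q A b"
      unfolding KKT_points_eq_pieces using y(1) by (auto simp: KKT_piece_def)
    moreover have "dist x y < \<epsilon>"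
      using dist_triangle[of x y p] small(1) y(2) by (simp add: dist_norm norm_minus_commute)
    ultimately show "\<exists>y\<in>KKT_points Q q A b. dist x y < \<epsilon>"
      by blast
  qed
qed

section \<open>The projected gradient flow\<close>

lemma quad_fun_has_derivative:
  assumes "transpose Q = Q"
  shows "(quad_fun Q q has_derivative (\<lambda>h. (Q *v x + q) \<bullet> h)) (at x)"
proof -
  have sym: "x \<bullet> (Q *v h) = h \<bullet> (Q *v x)" for h
    using dot_lmul_matrix[of x Q h] assms
    by (metis inner_commute transpose_matrix_vector)
  have "((\<lambda>x. (1/2) * (x \<bullet> (Q *v x)) + q \<bullet> x) has_derivative
      (\<lambda>h. (1/2) * (x \<bullet> (Q *v h) + h \<bullet> (Q *v x)) + q \<bullet> h)) (at x)"
    by (intro derivative_intros bounded_linear_imp_has_derivative matrix_vector_mul_bounded_linear)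
  then show ?thesis
    unfolding quad_fun_def[abs_def]
    by (simp add: sym inner_add_left inner_commute[of q] inner_commute[of "Q *v x"])
qed

text \<open>
  The velocity points from \<open>x s\<close> towards a feasible point.  For each constraint the slack,
  multiplied by the integrating factor \<open>exp (s / \<eta>)\<close>, is therefore nondecreasing.
\<close>

lemma trajectory_stays_feasible:
  assumes sol: "solves_projected_ivp \<eta> \<rho> Q q (feasible A b) x0 x"
    and "\<eta> > 0" and "x0 \<in> feasible A b" and "t \<ge> 0"
  shows "x t \<in> feasible A b"
proof -
  define p where "p s = closest_point (feasible A b) (x s - (1/\<rho>) *\<^sub>R (Q *v x s + q))" for s
  have pC: "p s \<in> feasible A b" for s
    unfolding p_def using assms(3) polyhedron_feasible
    by (intro closest_point_in_set polyhedron_imp_closed) auto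
  have x': "(x has_vector_derivative (1/\<eta>) *\<^sub>R (p s - x s)) (at s within {0..})" if "s \<ge> 0" for s
    using sol that unfolding solves_projected_ivp_def p_def by blast
  have "b $ i \<le> A $ i \<bullet> x t" for i
  proof (cases "t = 0")
    case True
    then show ?thesis
      using assms(3) sol
      by (auto simp: solves_projected_ivp_def feasible_def less_eq_vec_def matrix_vector_mul_component)
  next
    case False
    then have "0 < t" using \<open>t \<ge> 0\<close> by simp
    let ?g = "\<lambda>s. exp (s / \<eta>) * (A $ i \<bullet> x s - b $ i)"
    let ?g' = "\<lambda>s. exp (s / \<eta>) * (1/\<eta>) * (A $ i \<bullet> p s - b $ i)"
    have "(?g has_derivative (*) (?g' s)) (at s within {0..t})" if "0 \<le> s" "s \<le> t" for s
    proof -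
      have "(x has_derivative (\<lambda>h. h *\<^sub>R ((1/\<eta>) *\<^sub>R (p s - x s)))) (at s within {0..t})"
        using x'[OF that(1)] unfolding has_vector_derivative_def by (auto elim: has_derivative_subset)
      then have "(?g has_derivative (\<lambda>h. exp (s / \<eta>) * (A $ i \<bullet> (h *\<^sub>R ((1/\<eta>) *\<^sub>R (p s - x s))))
          + exp (s / \<eta>) * (h / \<eta>) * (A $ i \<bullet> x s - b $ i))) (at s within {0..t})"
        using \<open>\<eta> > 0\<close> by (auto intro!: derivative_eq_intros)
      moreover have "(\<lambda>h. exp (s / \<eta>) * (A $ i \<bullet> (h *\<^sub>R ((1/\<eta>) *\<^sub>R (p s - x s))))
          + exp (s / \<eta>) * (h / \<eta>) * (A $ i \<bullet> x s - b $ i)) = (*) (?g' s)"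
        by (rule ext) (simp add: inner_diff_right algebra_simps diff_divide_distrib)
      ultimately show ?thesis by simp
    qed
    from mvt_simple[OF \<open>0 < t\<close> this] obtain s where s: "?g t - ?g 0 = ?g' s * (t - 0)"
      by blast
    have "0 \<le> ?g' s"
      using pC[of s] \<open>\<eta> > 0\<close>
      by (intro mult_nonneg_nonneg) (auto simp: feasible_def less_eq_vec_def matrix_vector_mul_component)
    moreover have "0 \<le> ?g 0"
      using assms(3) sol
      by (simp add: solves_projected_ivp_def feasible_def less_eq_vec_def matrix_vector_mul_component)
    moreover have "0 \<le> ?g' s * (t - 0)"
      using \<open>0 \<le> ?g' s\<close> by (rule mult_nonneg_nonneg) (use \<open>0 < t\<close> in simp)
    ultimately have "0 \<le> ?g t"
      using s by linarith
    then show ?thesis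
      by (simp add: zero_le_mult_iff)
  qed
  then show ?thesis
    by (simp add: feasible_def less_eq_vec_def matrix_vector_mul_component)
qed

text \<open>
  The variational inequality for the projection, tested with the feasible point \<open>x\<close> itself.
\<close>

lemma projected_gradient_residual_descent:
  assumes "convex C" "closed C" "x \<in> C" "\<rho> > 0"
  shows "g \<bullet> (closest_point C (x - (1/\<rho>) *\<^sub>R g) - x)
           \<le> - \<rho> * (norm (closest_point C (x - (1/\<rho>) *\<^sub>R g) - x))\<^sup>2"
proof -
  let ?p = "closest_point C (x - (1/\<rho>) *\<^sub>R g)"
  have "(x - (1/\<rho>) *\<^sub>R g - ?p) \<bullet> (x - ?p) \<le> 0"
    by (rule closest_point_dot[OF assms(1-3)])
  moreover have "x - (1/\<rho>) *\<^sub>R g - ?p = (x - ?p) - (1/\<rho>) *\<^sub>R g"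
    by simp
  ultimately have "(norm (x - ?p))\<^sup>2 \<le> (1/\<rho>) * (g \<bullet> (x - ?p))"
    by (simp only: inner_diff_left[of "x - ?p"] inner_scaleR_left dot_square_norm diff_le_0_iff_le)
  then have "\<rho> * (norm (x - ?p))\<^sup>2 \<le> g \<bullet> (x - ?p)"
    using \<open>\<rho> > 0\<close> by (simp add: field_simps)
  then show ?thesis
    by (simp add: inner_diff_right norm_minus_commute)
qed

lemma projection_residual_lipschitz:
  fixes Q :: "real^'n^'n"
  assumes "convex C" "closed C" "C \<noteq> {}" "\<rho> > 0"
  shows "\<exists>L>0. \<forall>x y. norm ((closest_point C (x - (1/\<rho>) *\<^sub>R (Q *v x + q)) - x)
                    - (closest_point C (y - (1/\<rho>) *\<^sub>R (Q *v y + q)) - y)) \<le> L * norm (x - y)"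
proof -
  obtain K where K: "K > 0" "\<And>v. norm (Q *v v) \<le> norm v * K"
    using bounded_linear.pos_bounded[OF matrix_vector_mul_bounded_linear[of Q]] by blast
  show ?thesis
  proof (intro exI conjI allI)
    show "2 + K / \<rho> > 0" using K(1) \<open>\<rho> > 0\<close> by (simp add: add_pos_pos)
    fix x y
    let ?s = "\<lambda>x. x - (1/\<rho>) *\<^sub>R (Q *v x + q)"
    have "norm (closest_point C (?s x) - closest_point C (?s y)) \<le> norm (?s x - ?s y)"
      using closest_point_lipschitz[OF assms(1-3)] by (simp add: dist_norm)
    also have "?s x - ?s y = (x - y) - (1/\<rho>) *\<^sub>R (Q *v (x - y))"
      by (simp add: matrix_vector_mult_diff_distrib algebra_simps)
    also have "norm \<dots> \<le> norm (x - y) + norm ((1/\<rho>) *\<^sub>R (Q *v (x - y)))"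
      by (rule norm_triangle_ineq4)
    also have "\<dots> \<le> norm (x - y) + (1/\<rho>) * (norm (x - y) * K)"
      using K(2)[of "x - y"] \<open>\<rho> > 0\<close> by (simp add: divide_right_mono)
    finally have "norm (closest_point C (?s x) - closest_point C (?s y))
        \<le> norm (x - y) + (1/\<rho>) * (norm (x - y) * K)" .
    then have "norm (closest_point C (?s x) - closest_point C (?s y)) + norm (x - y)
        \<le> (2 + K / \<rho>) * norm (x - y)"
      by (simp add: algebra_simps)
    moreover have "norm ((closest_point C (?s x) - x) - (closest_point C (?s y) - y))
        \<le> norm (closest_point C (?s x) - closest_point C (?s y)) + norm (x - y)"
      using norm_triangle_ineq4[of "closest_point C (?s x) - closest_point C (?s y)" "x - y"]
      by (simp add: algebra_simps)
    ultimately show "norm ((closest_point C (?s x) - x) - (closest_point C (?s y) - y))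
        \<le> (2 + K / \<rho>) * norm (x - y)"
      by linarith
  qed
qed

text \<open>
  The objective \<open>f\<close> is the energy: on feasible states its derivative along the flow is at most
  \<open>- (\<rho> / \<eta>)\<close> times the squared norm of the residual.
\<close>

lemma residual_tendsto_zero:
  fixes Q :: "real^'n^'n" and A :: "real^'n^'m"
  assumes sym: "transpose Q = Q" and "\<eta> > 0" and "\<rho> > 0"
    and bdd: "bdd_below (quad_fun Q q ` feasible A b)"
    and x0: "x0 \<in> feasible A b"
    and sol: "solves_projected_ivp \<eta> \<rho> Q q (feasible A b) x0 x"
  shows "((\<lambda>t. closest_point (feasible A b) (x t - (1/\<rho>) *\<^sub>R (Q *v x t + q)) - x t) \<longlongrightarrow> 0) at_top"
proof -
  define r where "r t = closest_point (feasible A b) (x t - (1/\<rho>) *\<^sub>R (Q *v x t + q)) - x t" for t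
  have C: "convex (feasible A b)" "closed (feasible A b)" "feasible A b \<noteq> {}"
    using polyhedron_feasible x0 by (auto intro: polyhedron_imp_closed polyhedron_imp_convex)
  have feas: "x t \<in> feasible A b" if "t \<ge> 0" for t
    using trajectory_stays_feasible[OF sol \<open>\<eta> > 0\<close> x0 that] .
  obtain L where L: "L > 0" "\<And>s t. norm (r s - r t) \<le> L * norm (x s - x t)"
    unfolding r_def using projection_residual_lipschitz[OF C \<open>\<rho> > 0\<close>, of Q q] by blast
  have x': "(x has_vector_derivative (1/\<eta>) *\<^sub>R r t) (at t within {0..})" if "t \<ge> 0" for t
    using sol that unfolding solves_projected_ivp_def r_def by blast
  have f': "((\<lambda>t. quad_fun Q q (x t)) has_real_derivative ((1/\<eta>) * ((Q *v x t + q) \<bullet> r t))) (at t within {0..})"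
    if "t \<ge> 0" for t
  proof -
    have "((\<lambda>t. quad_fun Q q (x t)) has_derivative (\<lambda>h. (Q *v x t + q) \<bullet> (h *\<^sub>R ((1/\<eta>) *\<^sub>R r t))))
        (at t within {0..})"
      using x'[OF that] unfolding has_vector_derivative_def
      by (rule has_derivative_compose[OF _ quad_fun_has_derivative[OF sym]])
    moreover have "(\<lambda>h. (Q *v x t + q) \<bullet> (h *\<^sub>R ((1/\<eta>) *\<^sub>R r t))) = (*) ((1/\<eta>) * ((Q *v x t + q) \<bullet> r t))"
      by (rule ext) simp
    ultimately show ?thesis
      unfolding has_field_derivative_def by simp
  qed
  have decay: "(1/\<eta>) * ((Q *v x t + q) \<bullet> r t) \<le> - (\<rho> / \<eta>) * (norm (r t))\<^sup>2" if "t \<ge> 0" for t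
    using mult_left_mono[OF projected_gradient_residual_descent[OF C(1,2) feas[OF that] \<open>\<rho> > 0\<close>,
          of "Q *v x t + q"], of "1/\<eta>"] \<open>\<eta> > 0\<close>
    by (simp add: r_def)
  have "bdd_below ((\<lambda>t. quad_fun Q q (x t)) ` {0..})"
    using feas by (intro bdd_below_mono[OF bdd]) auto
  then have "(r \<longlongrightarrow> 0) at_top"
    using \<open>\<eta> > 0\<close> \<open>\<rho> > 0\<close> L decay f' x'
    by (intro residual_vanishes_by_energy_decay[where k = "1/\<eta>" and c = "\<rho> / \<eta>" and L = L
          and \<phi> = "\<lambda>t. quad_fun Q q (x t)"]) auto
  then show ?thesis
    unfolding r_def .
qed

theorem theorem5:
  fixes Q :: "real^'n^'n" and A :: "real^'n^'m"
    and q :: "real^'n" and b :: "real^'m"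
    and \<eta> \<rho> :: real
    and x0 :: "real^'n" and x :: "real \<Rightarrow> real^'n"
  assumes "transpose Q = Q"
    and "feasible A b \<noteq> {}"
    and "\<eta> > 0" and "\<rho> > 0"
    and "bdd_below (quad_fun Q q ` feasible A b)"
    and "x0 \<in> feasible A b"
    and "solves_projected_ivp \<eta> \<rho> Q q (feasible A b) x0 x"
  shows "KKT_points Q q A b \<noteq> {} \<and>
    ((\<lambda>t. infdist (x t) (KKT_points Q q A b)) \<longlongrightarrow> 0) at_top \<and>
    (\<exists>\<Omega> \<in> components (KKT_points Q q A b).
       (\<exists>F. finite F \<and> (\<forall>P\<in>F. polyhedron P) \<and> \<Omega> = \<Union>F) \<and> closed \<Omega> \<and>
       ((\<lambda>t. infdist (x t) \<Omega>) \<longlongrightarrow> 0) at_top) \<and>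
    (finite (KKT_points Q q A b) \<longrightarrow>
       (\<exists>xbar \<in> KKT_points Q q A b. (x \<longlongrightarrow> xbar) at_top))"
proof -
  let ?K = "KKT_points Q q A b"
  let ?\<F> = "range (KKT_piece Q q A b)"
  have fin: "finite ?\<F>" by simp
  have poly: "polyhedron P" if "P \<in> ?\<F>" for P
    using that polyhedron_KKT_piece by auto
  have K: "?K = \<Union>?\<F>"
    by (rule KKT_points_eq_pieces)
  \<comment> \<open>Phrased with points of the set instead of \<open>infdist\<close>, which is zero for the empty set.\<close>
  have near: "\<forall>\<^sub>F t in at_top. \<exists>y\<in>?K. dist (x t) y < \<epsilon>" if "\<epsilon> > 0" for \<epsilon>
  proof -
    obtain \<delta> where "\<delta> > 0" and \<delta>: "\<And>x. norm (closest_point (feasible A b) (x - (1/\<rho>) *\<^sub>R (Q *v x + q)) - x) < \<delta>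
           \<Longrightarrow> \<exists>y\<in>?K. dist x y < \<epsilon>"
      using small_residual_imp_near_KKT[OF assms(2) \<open>\<rho> > 0\<close> \<open>\<epsilon> > 0\<close>, of Q q] by blast
    from tendstoD[OF residual_tendsto_zero[OF assms(1,3-7)] \<open>\<delta> > 0\<close>]
    show ?thesis
      by eventually_elim (simp add: \<delta>)
  qed
  have "continuous_on {0..} x"
    unfolding continuous_on_eq_continuous_within
    using assms(7) has_vector_derivative_continuous unfolding solves_projected_ivp_def by (metis atLeast_iff)
  moreover obtain \<delta> where "\<delta> > 0"
    "\<And>\<Omega> p r. \<lbrakk>\<Omega> \<in> components ?K; p \<in> \<Omega>; r \<in> ?K - \<Omega>\<rbrakk> \<Longrightarrow> \<delta> \<le> dist p r"
    unfolding K using finite_union_polyhedra_components_apart[OF fin poly] by blast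
  ultimately obtain \<Omega> where \<Omega>: "\<Omega> \<in> components ?K"
    and near\<Omega>: "\<And>\<epsilon>. \<epsilon> > 0 \<Longrightarrow> \<forall>\<^sub>F t in at_top. \<exists>y\<in>\<Omega>. dist (x t) y < \<epsilon>"
    using path_selects_component[of x ?K, OF _ near] by blast
  have \<Omega>eq: "\<Omega> = \<Union>{P\<in>?\<F>. P \<subseteq> \<Omega>}"
    using finite_union_polyhedra_component[OF poly] \<Omega> unfolding K by blast
  have \<Omega>fin: "finite {P\<in>?\<F>. P \<subseteq> \<Omega>}"
    using fin by simp
  have "closed (\<Union>{P\<in>?\<F>. P \<subseteq> \<Omega>})"
    using \<Omega>fin poly by (intro closed_Union) (auto intro: polyhedron_imp_closed)
  then have "closed \<Omega>"
    using \<Omega>eq by simp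
  have "\<exists>xbar\<in>?K. (x \<longlongrightarrow> xbar) at_top" if "finite ?K"
  proof -
    have "finite \<Omega>"
      using finite_subset[OF in_components_subset[OF \<Omega>] that] .
    then obtain a where a: "\<Omega> = {a}"
      using connected_finite_iff_sing[OF in_components_connected[OF \<Omega>]] in_components_nonempty[OF \<Omega>]
      by blast
    have "(x \<longlongrightarrow> a) at_top"
      using near\<Omega> by (intro tendstoI) (simp add: a)
    then show ?thesis
      using in_components_subset[OF \<Omega>] a by blast
  qed
  moreover have "?K \<noteq> {}"
    using \<Omega> in_components_subset in_components_nonempty by blast
  moreover have "\<exists>F. finite F \<and> (\<forall>P\<in>F. polyhedron P) \<and> \<Omega> = \<Union>F"
    using \<Omega>fin \<Omega>eq poly by (intro exI[of _ "{P\<in>?\<F>. P \<subseteq> \<Omega>}"]) blast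
  ultimately show ?thesis
    using \<Omega> \<open>closed \<Omega>\<close> tendsto_infdist_zero[OF near] tendsto_infdist_zero[OF near\<Omega>]
    by blast
qed

end
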